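(* Let $n\ge2$. For any convex polytope $\mathcal C$ in $\mathbb R^n$ with nonempty interior there exists a bounded set $U\subset\mathbb R^n$ such that if $O\notin U$ (and $O\notin\mathcal C$), and $[A^*B^*]$ is a local maximizer for the function $G$ corresponding to $\mathcal C$ and $O$, then $$d_{\mathcal C}(A^* )+d_{\mathcal C}(B^* )\le n-1.$$ In particular, when $n=2$, at least one of the points $A^*$ and $B^*$ is a vertex of the polygon $\mathcal C$.
   Context: A convex polytope is the convex hull of finitely many points. $\partial\mathcal C$ is the boundary of $\mathcal C$; $|AB|$ is the Euclidean length of $[AB]$. For a point $O\notin\mathcal C$, consider all segments $[AB]$ with end-points $A,B\in\partial\mathcal C$ such that the line $AB$ passes through $O$ and $B\in[OA]$; put $G([AB])=|AB|$ for such segments. Such a segment $[A^*B^*]$ is a local maximizer for $G$ if there are open sets $U'\ni A^*$ and $V'\ni B^*$ such that $|AB|\le|A^*B^*|$ for every such segment $[AB]$ with $A\in\partial\mathcal C\cap U'$ and $B\in\partial\mathcal C\cap V'$. For $A\in\mathcal C$, the dimension $d_{\mathcal C}(A)$ of $A$ with respect to $\mathcal C$ is the maximal integer $k$ for which there exists a $k$-dimensional affine subspace $H\subset\mathbb R^n$ such that $A$ belongs to the interior of $H\cap\mathcal C$ relative to $H$. *)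

theory Defs
  imports "HOL-Analysis.Analysis"
begin

text \<open>
  The segments \<open>[AB]\<close> on lines through \<open>P\<close>, with \<open>A\<close> the end-point farther from \<open>P\<close>.
  The condition \<open>A \<noteq> B\<close> is what makes ``the line \<open>AB\<close>'' meaningful. Without it every point
  of the relative interior of a facet whose hyperplane misses \<open>P\<close> would give a local
  maximizer of length \<open>0\<close>.
\<close>

definition chord :: "'a::euclidean_space set \<Rightarrow> 'a \<Rightarrow> 'a \<Rightarrow> 'a \<Rightarrow> bool" where
  "chord C P A B \<longleftrightarrow>
     A \<in> frontier C \<and> B \<in> frontier C \<and> A \<noteq> B \<and>
     P \<in> affine hull {A, B} \<and> B \<in> closed_segment P A"

definition chord_local_maximizer :: "'a::euclidean_space set \<Rightarrow> 'a \<Rightarrow> 'a \<Rightarrow> 'a \<Rightarrow> bool" where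
  "chord_local_maximizer C P A' B' \<longleftrightarrow>
     chord C P A' B' \<and>
     (\<exists>U V. open U \<and> A' \<in> U \<and> open V \<and> B' \<in> V \<and>
        (\<forall>A B. chord C P A B \<and> A \<in> frontier C \<inter> U \<and> B \<in> frontier C \<inter> V \<longrightarrow>
           dist A B \<le> dist A' B'))"

definition slice_dims :: "'a::euclidean_space set \<Rightarrow> 'a \<Rightarrow> int set" where
  "slice_dims C A =
     {k. \<exists>H. affine H \<and> aff_dim H = k \<and> A \<in> (top_of_set H) interior_of (H \<inter> C)}"

definition point_dim :: "'a::euclidean_space set \<Rightarrow> 'a \<Rightarrow> int" where
  "point_dim C A = Max (slice_dims C A)"

text \<open>The maximum exists for every point of \<open>C\<close>.\<close>

lemma finite_slice_dims: "finite (slice_dims C (A::'a::euclidean_space))"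
proof (rule finite_subset)
  show "slice_dims C A \<subseteq> {-1..int DIM('a)}"
    by (auto simp: slice_dims_def aff_dim_geq aff_dim_le_DIM)
qed simp

lemma zero_in_slice_dims:
  assumes "A \<in> C"
  shows "0 \<in> slice_dims C (A::'a::euclidean_space)"
proof -
  have "{A} \<inter> C = {A}"
    using assms by blast
  then have "A \<in> (top_of_set {A}) interior_of ({A} \<inter> C)"
    using interior_of_topspace[of "top_of_set {A}"] by simp
  then show ?thesis
    unfolding slice_dims_def using affine_sing aff_dim_sing by blast
qed

end

theory Submission imports Defs begin

text \<open>
  Let \<open>A\<close> and \<open>B\<close> lie in the relative interiors of the faces \<open>F\<close> and \<open>G\<close>, and suppose that
  \<open>dim F + dim G \<ge> n\<close>. If \<open>F\<close> and \<open>G\<close> have a common direction \<open>u\<close>, move \<open>A\<close> along \<open>u\<close>: the length of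
  the chord is proportional to \<open>|PA|\<close>, and by the parallelogram law it grows in one of the two
  senses. Otherwise the affine hulls of \<open>F\<close> and \<open>G\<close> meet in a single point \<open>Q\<close>. Moving \<open>A\<close> along the
  line \<open>QA\<close> and \<open>B\<close> along the line \<open>QB\<close>, the derivative of the length can vanish only if
  \<open>|QA| \<ge> |PB|\<close>. As there are finitely many such points \<open>Q\<close>, this fails for \<open>P\<close> far away.
\<close>

section \<open>Faces through a point and the dimension of the point\<close>

text \<open>A minimal face through \<open>x\<close>, which exists because the faces are finitely
  many, works: if \<open>x\<close> were on its relative frontier, a smaller face would contain
  \<open>x\<close>.\<close>

lemma polytope_point_in_rel_interior_face:
  fixes C :: "'a::euclidean_space set"
  assumes "polytope C" "x \<in> C"
  obtains F where "F face_of C" "x \<in> rel_interior F"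
proof -
  let ?\<F> = "{F. F face_of C \<and> x \<in> F}"
  have "C \<in> ?\<F>"
    using assms by (simp add: face_of_refl polytope_imp_convex)
  moreover have "finite ?\<F>"
    using finite_polytope_faces[OF assms(1)] by simp
  ultimately obtain F where F: "F \<in> ?\<F>" and min: "\<And>G. G \<in> ?\<F> \<Longrightarrow> G \<subseteq> F \<Longrightarrow> G = F"
    using finite_has_minimal[of ?\<F>] by blast
  have polyF: "polytope F"
    using F assms face_of_polytope_polytope by blast
  have "x \<in> rel_interior F"
  proof (rule ccontr)
    assume "x \<notin> rel_interior F"
    then have "x \<in> rel_frontier F"
      using F closure_subset unfolding rel_frontier_def by blast
    then obtain G where "G face_of F" "G \<noteq> F" "x \<in> G"
      using rel_frontier_of_polyhedron_alt[OF polytope_imp_polyhedron[OF polyF]] by blast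
    then show False
      using F min[of G] face_of_trans face_of_imp_subset by blast
  qed
  then show thesis
    using F that by blast
qed

text \<open>This keeps a perturbed end-point in its face: it is enough to move it continuously
  within the affine hull of the face.\<close>

lemma eventually_in_rel_interior:
  assumes "x \<in> rel_interior S" "(g \<longlongrightarrow> x) F" "\<forall>\<^sub>F t in F. g t \<in> affine hull S"
  shows "\<forall>\<^sub>F t in F. g t \<in> S"
proof -
  obtain T where "open T" "x \<in> T" "T \<inter> affine hull S \<subseteq> S"
    using assms(1) unfolding mem_rel_interior by blast
  then show ?thesis
    using eventually_conj[OF topological_tendstoD[OF assms(2), of T] assms(3)]
    by (auto elim: eventually_mono)
qed

text \<open>If \<open>x\<close> is interior to \<open>H \<inter> C\<close> relative to
  \<open>H\<close>, every line of \<open>H\<close> through \<open>x\<close> carries a segment of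
  \<open>C\<close> centred at \<open>x\<close>. The face property puts the ends of this segment in
  \<open>F\<close>, hence \<open>H\<close> lies in the affine hull of \<open>F\<close>.\<close>

lemma point_dim_le_aff_dim_face:
  fixes C :: "'a::euclidean_space set"
  assumes "F face_of C" "x \<in> F"
  shows "point_dim C x \<le> aff_dim F"
proof -
  have "x \<in> C"
    using assms face_of_imp_subset by blast
  have "k \<le> aff_dim F" if k: "k \<in> slice_dims C x" for k
  proof -
    from k obtain H where H: "affine H" "aff_dim H = k"
      and int: "x \<in> (top_of_set H) interior_of (H \<inter> C)"
      unfolding slice_dims_def by blast
    obtain T where T: "open T" "x \<in> T" "H \<inter> T \<subseteq> H \<inter> C" and "x \<in> H"
      using int unfolding interior_of_def openin_open by blast
    then obtain e where e: "e > 0" "ball x e \<subseteq> T"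
      using open_contains_ball by blast
    have "H \<subseteq> affine hull F"
    proof
      fix y assume "y \<in> H"
      show "y \<in> affine hull F"
      proof (cases "y = x")
        case True
        then show ?thesis using assms hull_subset[of F affine] by blast
      next
        case False
        \<comment> \<open>This factor gives the displacement norm \<open>e / 2\<close>, so both
          symmetric points around \<open>x\<close> stay in the ball.\<close>
        define d where "d = e / (2 * norm (y - x))"
        have d: "d > 0" "norm (d *\<^sub>R (y - x)) < e"
          using e False by (auto simp: d_def)
        have mem: "x + c *\<^sub>R (y - x) \<in> H" for c
          using mem_affine[OF H(1) \<open>x \<in> H\<close> \<open>y \<in> H\<close>, of "1 - c" c]
          by (simp add: algebra_simps)
        have "x + d *\<^sub>R (y - x) \<in> C" "x + (- d) *\<^sub>R (y - x) \<in> C"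
          using mem[of d] mem[of "-d"] T(3) e(2) d
          by (auto simp: subset_iff dist_norm)
        moreover have "x \<in> open_segment (x + d *\<^sub>R (y - x)) (x + (- d) *\<^sub>R (y - x))"
        proof -
          have "x = midpoint (x + d *\<^sub>R (y - x)) (x + (- d) *\<^sub>R (y - x))"
            by (simp add: midpoint_def algebra_simps flip: scaleR_2)
          moreover have "x + d *\<^sub>R (y - x) \<noteq> x + (- d) *\<^sub>R (y - x)"
            using d False by (simp add: eq_neg_iff_add_eq_0 flip: scaleR_2)
          ultimately show ?thesis
            by (metis midpoint_in_open_segment)
        qed
        ultimately have "x + d *\<^sub>R (y - x) \<in> F"
          using assms unfolding face_of_def by blast
        \<comment> \<open>The point \<open>y\<close> is recovered on the line through
          \<open>x\<close> and the point just placed in \<open>F\<close>.\<close>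
        then have "(1 - 1/d) *\<^sub>R x + (1/d) *\<^sub>R (x + d *\<^sub>R (y - x)) \<in> affine hull F"
          using assms by (intro mem_affine) (auto intro: hull_inc)
        then show ?thesis
          using d by (simp add: algebra_simps)
      qed
    qed
    then show ?thesis
      using aff_dim_subset[of H "affine hull F"] H by simp
  qed
  moreover have "slice_dims C x \<noteq> {}"
    using zero_in_slice_dims[OF \<open>x \<in> C\<close>] by blast
  ultimately show ?thesis
    unfolding point_dim_def using finite_slice_dims[of C x] by (simp add: Max_le_iff)
qed

section \<open>Affine subspaces whose dimensions add up to at least that of the space\<close>

text \<open>If the direction spaces \<open>L\<close> and \<open>M\<close> meet only in 0, the
  dimension formula makes \<open>L + M\<close> the whole space. Decomposing \<open>y - x\<close>
  then gives a common point, and the difference of two common points lies in both \<open>L\<close>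
  and \<open>M\<close>.\<close>

lemma affine_common_direction_or_single_Int:
  fixes S T :: "'a::euclidean_space set"
  assumes "affine S" "affine T" "x \<in> S" "y \<in> T"
    and dims: "aff_dim S + aff_dim T \<ge> int DIM('a)"
  obtains u where "u \<noteq> 0" "\<And>t. x + t *\<^sub>R u \<in> S" "\<And>t. y + t *\<^sub>R u \<in> T"
  | q where "S \<inter> T = {q}"
proof -
  define L where "L = (\<lambda>z. - x + z) ` S"
  define M where "M = (\<lambda>z. - y + z) ` T"
  have sub: "subspace L" "subspace M"
    unfolding L_def M_def
    using affine_diffs_subspace[OF assms(1,3)] affine_diffs_subspace[OF assms(2,4)] by auto
  have L: "u \<in> L \<longleftrightarrow> x + u \<in> S" for u
    unfolding L_def by (auto simp: image_iff algebra_simps intro!: bexI[of _ "x + u"])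
  have M: "u \<in> M \<longleftrightarrow> y + u \<in> T" for u
    unfolding M_def by (auto simp: image_iff algebra_simps intro!: bexI[of _ "y + u"])
  show thesis
  proof (cases "L \<inter> M = {0}")
    case False
    then obtain u where "u \<in> L" "u \<in> M" "u \<noteq> 0"
      using sub subspace_0 by blast
    then show thesis
      using that(1)[of u] sub L M subspace_scale by blast
  next
    case True
    have "aff_dim L = aff_dim S" "aff_dim M = aff_dim T"
      unfolding L_def M_def by (rule aff_dim_translation_eq)+
    then have "dim L + dim M \<ge> DIM('a)"
      using dims sub by (simp add: aff_dim_subspace)
    moreover have "dim {a + b |a b. a \<in> L \<and> b \<in> M} + dim (L \<inter> M) = dim L + dim M"
      using dim_sums_Int[OF sub] .
    ultimately have "dim {a + b |a b. a \<in> L \<and> b \<in> M} = DIM('a)"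
      using True dim_subset_UNIV[of "{a + b |a b. a \<in> L \<and> b \<in> M}"] by simp
    then have "span {a + b |a b. a \<in> L \<and> b \<in> M} = UNIV"
      by (simp only: dim_eq_full)
    then have "{a + b |a b. a \<in> L \<and> b \<in> M} = UNIV"
      unfolding span_eq_iff[THEN iffD2, OF subspace_sums[OF sub]] .
    then obtain a b where ab: "y - x = a + b" "a \<in> L" "b \<in> M"
      by blast
    have q: "x + a \<in> S" "x + a = y + - b" "y + - b \<in> T"
      using ab L M[of "-b"] sub subspace_neg by (auto simp: algebra_simps)
    have "z = x + a" if "z \<in> S" "z \<in> T" for z
    proof -
      have "z - x \<in> L" "z - y \<in> M"
        using that L[of "z - x"] M[of "z - y"] by auto
      then have "(z - x) - a \<in> L" "(z - y) - (- b) \<in> M"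
        using ab sub subspace_diff subspace_neg by blast+
      moreover have "(z - x) - a = (z - y) - (- b)"
        using ab by (simp add: algebra_simps)
      ultimately have "(z - x) - a \<in> L" "(z - x) - a \<in> M"
        by metis+
      then have "(z - x) - a = 0"
        using True by blast
      then show ?thesis
        by (simp add: algebra_simps)
    qed
    moreover have "x + a \<in> T"
      using q by metis
    ultimately have "S \<inter> T = {x + a}"
      using q(1) by blast
    then show thesis
      by (rule that(2))
  qed
qed

section \<open>Chords described by their ratio, and their perturbations\<close>

text \<open>The ratio 0 would give \<open>B = P\<close>, and the ratio 1 would give
  \<open>B = A\<close>.\<close>

lemma chord_ratio:
  assumes "chord C P A B" "B \<noteq> P"
  obtains l where "0 < l" "l < 1" "B = P + l *\<^sub>R (A - P)"
proof -
  obtain l where l: "0 \<le> l" "l \<le> 1" "B = (1 - l) *\<^sub>R P + l *\<^sub>R A"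
    using assms unfolding chord_def closed_segment_def by blast
  then have "l \<noteq> 0" "l \<noteq> 1"
    using assms unfolding chord_def by auto
  with l that[of l] show thesis
    by (simp add: algebra_simps)
qed

lemma chordI_ratio:
  assumes "A \<in> frontier C" "B \<in> frontier C" "A \<noteq> P" "0 < m" "m < 1" "B = P + m *\<^sub>R (A - P)"
  shows "chord C P A B"
proof -
  have ne: "A \<noteq> B"
  proof
    assume "A = B"
    then have "(1 - m) *\<^sub>R (A - P) = 0"
      using assms(6) by (simp add: algebra_simps)
    then show False
      using assms by simp
  qed
  have B: "B = (1 - m) *\<^sub>R P + m *\<^sub>R A"
    using assms(6) by (simp add: algebra_simps)
  \<comment> \<open>Solving \<open>B = (1 - m) P + m A\<close> for \<open>P\<close> gives these
    affine coefficients; the factor \<open>1 - m\<close> clears the denominators.\<close>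
  have "(1 - m) *\<^sub>R ((- m / (1 - m)) *\<^sub>R A + (1 / (1 - m)) *\<^sub>R B) = (1 - m) *\<^sub>R P"
    using assms(5) by (simp add: B scaleR_add_right)
  then have "P = (- m / (1 - m)) *\<^sub>R A + (1 / (1 - m)) *\<^sub>R B"
    using assms(5) by simp
  moreover have "- m / (1 - m) + 1 / (1 - m) = 1"
    using assms(5) by (simp add: field_simps)
  ultimately have "P \<in> affine hull {A, B}"
    unfolding affine_hull_2 by blast
  moreover have "B \<in> closed_segment P A"
    unfolding closed_segment_def using B assms by auto
  ultimately show ?thesis
    unfolding chord_def using assms ne by blast
qed

text \<open>For small \<open>t\<close>, the points \<open>a t\<close> and
  \<open>P + m t (a t - P)\<close> stay in the faces \<open>F\<close> and \<open>G\<close>, so they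
  are the ends of a nearby chord. Its length is \<open>1 - m t\<close> times the distance from
  \<open>P\<close> to \<open>a t\<close>; squaring makes it accessible to inner products and
  derivatives.\<close>

lemma chord_local_maximizer_perturb:
  fixes C :: "'a::euclidean_space set" and m :: "real \<Rightarrow> real"
  assumes max: "chord_local_maximizer C P A B" and "A \<noteq> P"
    and F: "A \<in> rel_interior F" "F \<subseteq> frontier C"
    and G: "B \<in> rel_interior G" "G \<subseteq> frontier C"
    and m: "isCont m 0" "0 < m 0" "m 0 < 1" "B = P + m 0 *\<^sub>R (A - P)"
    and a: "isCont a 0" "a 0 = A" "\<forall>\<^sub>F t in at 0. a t \<in> affine hull F"
    and b: "\<forall>\<^sub>F t in at 0. P + m t *\<^sub>R (a t - P) \<in> affine hull G"
  obtains d where "d > 0"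
    "\<And>t. \<bar>t\<bar> < d \<Longrightarrow> (1 - m t)\<^sup>2 * ((a t - P) \<bullet> (a t - P)) \<le> (1 - m 0)\<^sup>2 * ((A - P) \<bullet> (A - P))"
proof -
  let ?b = "\<lambda>t. P + m t *\<^sub>R (a t - P)"
  have lim_m: "m \<midarrow>0\<rightarrow> m 0" and lim_a: "a \<midarrow>0\<rightarrow> A"
    using m a by (auto simp: isCont_def)
  have lim_b: "?b \<midarrow>0\<rightarrow> B"
    unfolding m(4) by (intro tendsto_intros lim_m lim_a)
  have dist: "(dist X (P + r *\<^sub>R (X - P)))\<^sup>2 = (1 - r)\<^sup>2 * ((X - P) \<bullet> (X - P))" for X r
  proof -
    have "X - (P + r *\<^sub>R (X - P)) = (1 - r) *\<^sub>R (X - P)"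
      by (simp add: algebra_simps)
    then show ?thesis
      by (simp add: dist_norm power_mult_distrib power2_norm_eq_inner)
  qed
  obtain U V where UV: "open U" "A \<in> U" "open V" "B \<in> V"
    and le: "\<And>X Y. chord C P X Y \<Longrightarrow> X \<in> U \<Longrightarrow> Y \<in> V \<Longrightarrow> dist X Y \<le> dist A B"
    using max unfolding chord_local_maximizer_def chord_def by blast
  have "\<forall>\<^sub>F t in at 0. a t \<in> F" "\<forall>\<^sub>F t in at 0. ?b t \<in> G"
    using eventually_in_rel_interior[OF F(1) lim_a a(3)]
      eventually_in_rel_interior[OF G(1) lim_b b] by auto
  moreover have "\<forall>\<^sub>F t in at 0. a t \<in> U" "\<forall>\<^sub>F t in at 0. ?b t \<in> V"
    using topological_tendstoD[OF lim_a] topological_tendstoD[OF lim_b] UV by auto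
  moreover have "\<forall>\<^sub>F t in at 0. 0 < m t" "\<forall>\<^sub>F t in at 0. m t < 1"
    using order_tendstoD[OF lim_m] m by auto
  moreover have "\<forall>\<^sub>F t in at 0. a t \<noteq> P"
    using tendsto_imp_eventually_ne[OF lim_a \<open>A \<noteq> P\<close>] .
  ultimately have "\<forall>\<^sub>F t in at 0. (dist (a t) (?b t))\<^sup>2 \<le> (dist A B)\<^sup>2"
  proof eventually_elim
    case (elim t)
    then have "chord C P (a t) (?b t)"
      using F G by (intro chordI_ratio[of _ _ _ _ "m t"]) auto
    then show ?case
      using le[of "a t" "?b t"] elim by (intro power_mono) auto
  qed
  then have "\<forall>\<^sub>F t in at 0. (1 - m t)\<^sup>2 * ((a t - P) \<bullet> (a t - P)) \<le> (1 - m 0)\<^sup>2 * ((A - P) \<bullet> (A - P))"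
    unfolding dist m(4) .
  then obtain d where "d > 0" and
    d: "\<And>t. t \<noteq> 0 \<Longrightarrow> \<bar>t\<bar> < d \<Longrightarrow>
      (1 - m t)\<^sup>2 * ((a t - P) \<bullet> (a t - P)) \<le> (1 - m 0)\<^sup>2 * ((A - P) \<bullet> (A - P))"
    unfolding eventually_at by (auto simp: dist_real_def)
  show thesis
  proof (rule that[OF \<open>d > 0\<close>])
    show "(1 - m t)\<^sup>2 * ((a t - P) \<bullet> (a t - P)) \<le> (1 - m 0)\<^sup>2 * ((A - P) \<bullet> (A - P))" if "\<bar>t\<bar> < d" for t
      using d[of t] that a(2) by (cases "t = 0") auto
  qed
qed

section \<open>Necessary conditions for a local maximizer\<close>

text \<open>Keeping the ratio \<open>l\<close> fixed, a shift of \<open>A\<close> by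
  \<open>t u\<close> shifts \<open>B\<close> by \<open>l t u\<close>, so both ends stay in the
  affine hulls of their faces.\<close>

lemma chord_local_maximizer_no_common_direction:
  fixes C :: "'a::euclidean_space set"
  assumes max: "chord_local_maximizer C P A B" and "B \<noteq> P"
    and F: "A \<in> rel_interior F" "F \<subseteq> frontier C"
    and G: "B \<in> rel_interior G" "G \<subseteq> frontier C"
    and u: "\<And>t. A + t *\<^sub>R u \<in> affine hull F" "\<And>t. B + t *\<^sub>R u \<in> affine hull G"
  shows "u = 0"
proof -
  have "chord C P A B"
    using max unfolding chord_local_maximizer_def by blast
  then obtain l where l: "0 < l" "l < 1" "B = P + l *\<^sub>R (A - P)"
    using chord_ratio \<open>B \<noteq> P\<close> by metis
  then have "A \<noteq> P"
    using \<open>B \<noteq> P\<close> by auto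
  have "P + l *\<^sub>R (A + t *\<^sub>R u - P) \<in> affine hull G" for t
    using u(2)[of "l * t"] l(3) by (simp add: algebra_simps)
  then obtain d where "d > 0" and d: "\<And>t. \<bar>t\<bar> < d \<Longrightarrow>
      (1 - l)\<^sup>2 * ((A + t *\<^sub>R u - P) \<bullet> (A + t *\<^sub>R u - P)) \<le> (1 - l)\<^sup>2 * ((A - P) \<bullet> (A - P))"
    using l u(1) by (rule_tac chord_local_maximizer_perturb
        [OF max \<open>A \<noteq> P\<close> F G, of "\<lambda>_. l" "\<lambda>t. A + t *\<^sub>R u"]) (auto intro!: continuous_intros)
  have le: "(A + t *\<^sub>R u - P) \<bullet> (A + t *\<^sub>R u - P) \<le> (A - P) \<bullet> (A - P)" if "\<bar>t\<bar> < d" for t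
    using d[OF that] l by simp
  \<comment> \<open>Adding the inequalities for the two opposite shifts cancels the terms linear in
    \<open>u\<close>.\<close>
  have "2 * ((d/2)\<^sup>2 * (u \<bullet> u)) \<le> 0"
    using le[of "d/2"] le[of "- (d/2)"] \<open>d > 0\<close>
    by (simp add: inner_add_left inner_add_right inner_diff_left inner_diff_right
        inner_commute power2_eq_square algebra_simps)
  then show ?thesis
    using \<open>d > 0\<close> inner_ge_zero[of u] by (auto simp: mult_le_0_iff)
qed

text \<open>With \<open>w = A - P\<close> and \<open>q = Q - A\<close>, stationarity of the squared
  length along the family given by \<open>Q\<close> means that \<open>w \<bullet> q\<close> equals
  \<open>l\<close> times the square of \<open>norm w\<close>. Cauchy-Schwarz yields
  \<open>l * norm w \<le> norm q\<close>, and the left side is the distance from \<open>P\<close> to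
  \<open>B\<close>.\<close>

lemma chord_local_maximizer_far_Int:
  fixes C :: "'a::euclidean_space set"
  assumes max: "chord_local_maximizer C P A B" and "B \<noteq> P"
    and F: "A \<in> rel_interior F" "F \<subseteq> frontier C"
    and G: "B \<in> rel_interior G" "G \<subseteq> frontier C"
    and Q: "Q \<in> affine hull F" "Q \<in> affine hull G"
  shows "dist P B \<le> dist Q A"
proof (rule ccontr)
  assume far: "\<not> dist P B \<le> dist Q A"
  have "chord C P A B"
    using max unfolding chord_local_maximizer_def by blast
  then obtain l where l: "0 < l" "l < 1" "B = P + l *\<^sub>R (A - P)"
    using chord_ratio \<open>B \<noteq> P\<close> by metis
  then have "A \<noteq> P"
    using \<open>B \<noteq> P\<close> by auto
  define w q where "w = A - P" and "q = Q - A"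
  text \<open>Where defined, the line through \<open>P\<close> and \<open>a t\<close> meets the line \<open>QB\<close> in \<open>P + m t (a t - P)\<close>.\<close>
  define m where "m = (\<lambda>t. l / (1 - t * (1 - l)))"
  define a where "a = (\<lambda>t. A + t *\<^sub>R q)"
  have m0: "m 0 = l" and a0: "a 0 = A"
    by (simp_all add: m_def a_def)
  have dm: "(m has_real_derivative l * (1 - l)) (at 0)"
    unfolding m_def by (auto intro!: derivative_eq_intros simp: algebra_simps)
  have cont_a: "isCont a 0"
    unfolding a_def by (intro continuous_intros)
  have a_hull: "a t \<in> affine hull F" for t
    using mem_affine[OF affine_affine_hull _ Q(1), of A "1 - t" t]
      F(1) rel_interior_subset[of F] hull_inc[of A F affine]
    by (auto simp: a_def q_def algebra_simps)
  have B_hull: "B \<in> affine hull G"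
    using G(1) rel_interior_subset[of G] hull_inc[of B G affine] by blast
  have "\<forall>\<^sub>F t in at 0. 1 - t * (1 - l) \<noteq> 0"
    by (rule tendsto_imp_eventually_ne[of _ 1]) (auto intro!: tendsto_eq_intros)
  then have b_hull: "\<forall>\<^sub>F t in at 0. P + m t *\<^sub>R (a t - P) \<in> affine hull G"
  proof eventually_elim
    case (elim t)
    \<comment> \<open>This is the parameter of the second end-point on the line from
      \<open>B\<close> to \<open>Q\<close>.\<close>
    define r where "r = m t * t"
    have m: "m t = l + r * (1 - l)"
      using elim by (simp add: r_def m_def field_simps)
    have "P + m t *\<^sub>R (a t - P) = P + m t *\<^sub>R (A - P) + r *\<^sub>R (Q - A)"
      by (simp add: a_def q_def r_def algebra_simps)
    also have "\<dots> = (1 - r) *\<^sub>R B + r *\<^sub>R Q"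
      unfolding m l(3) by (simp add: algebra_simps)
    also have "\<dots> \<in> affine hull G"
      using mem_affine[OF affine_affine_hull B_hull Q(2)] by simp
    finally show ?case .
  qed
  define f where "f = (\<lambda>t. (1 - m t)\<^sup>2 * ((a t - P) \<bullet> (a t - P)))"
  obtain d where "d > 0" and d: "\<And>t. \<bar>t\<bar> < d \<Longrightarrow> f t \<le> f 0"
    using chord_local_maximizer_perturb[OF max \<open>A \<noteq> P\<close> F G DERIV_isCont[OF dm] _ _ _ cont_a a0 _ b_hull]
      l a_hull unfolding f_def m0 a0 by auto
  have "f = (\<lambda>t. (1 - m t)\<^sup>2 * (w \<bullet> w + 2 * t * (w \<bullet> q) + t\<^sup>2 * (q \<bullet> q)))"
    by (simp add: f_def a_def w_def inner_add_left inner_add_right inner_diff_left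
        inner_diff_right inner_commute power2_eq_square algebra_simps)
  then have "(f has_real_derivative 2 * (1 - l)\<^sup>2 * (w \<bullet> q - l * (w \<bullet> w))) (at 0)"
    by (auto intro!: derivative_eq_intros dm simp: m0 power2_eq_square algebra_simps)
  then have "2 * (1 - l)\<^sup>2 * (w \<bullet> q - l * (w \<bullet> w)) = 0"
    by (rule DERIV_local_max[OF _ \<open>d > 0\<close>]) (use d in auto)
  then have "l * (norm w * norm w) = w \<bullet> q"
    using l by (simp add: norm_eq_sqrt_inner)
  also have "\<dots> \<le> norm w * norm q"
    by (rule norm_cauchy_schwarz)
  finally have "norm w * (l * norm w) \<le> norm w * norm q"
    by (simp add: mult_ac)
  then have "l * norm w \<le> norm q"
    using \<open>A \<noteq> P\<close> by (simp add: w_def)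
  moreover have "dist P B = l * norm w"
    using l by (simp add: dist_norm w_def)
  ultimately show False
    using far by (simp add: q_def dist_norm)
qed

section \<open>The exceptional ball and the dimension bound\<close>

theorem proposition30:
  fixes C :: "(real ^ 'n) set"
  assumes "CARD('n) \<ge> 2"
    and "polytope C"
    and "interior C \<noteq> {}"
  shows "\<exists>U :: (real ^ 'n) set. bounded U \<and>
    (\<forall>P A B. P \<notin> U \<and> P \<notin> C \<and> chord_local_maximizer C P A B \<longrightarrow>
       point_dim C A + point_dim C B \<le> int CARD('n) - 1 \<and>
       (CARD('n) = 2 \<longrightarrow> A extreme_point_of C \<or> B extreme_point_of C))"
proof -
  \<comment> \<open>Pairs of faces whose affine hulls do not meet in exactly one point contribute an
    unspecified value; this is harmless, since \<open>S\<close> remains finite.\<close>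
  define S where "S = (\<lambda>(F, G). THE q. affine hull F \<inter> affine hull G = {q}) `
    ({F. F face_of C} \<times> {G. G face_of C})"
  have "finite S"
    unfolding S_def using finite_polytope_faces[OF \<open>polytope C\<close>] by simp
  then have "bounded (S \<union> C)"
    using \<open>polytope C\<close> by (simp add: finite_imp_bounded polytope_imp_bounded)
  then obtain r where "r > 0" and r: "\<And>x. x \<in> S \<union> C \<Longrightarrow> norm x \<le> r"
    unfolding bounded_pos by blast
  have closed: "closed C"
    using \<open>polytope C\<close> by (simp add: polytope_imp_closed)
  \<comment> \<open>The radius comes from the far-point bound:
    \<open>dist P B \<le> dist q A\<close> is at most \<open>2 * r\<close>, and
    \<open>norm B \<le> r\<close>, which together give \<open>norm P \<le> 3 * r\<close>.\<close>
  have "point_dim C A + point_dim C B \<le> int CARD('n) - 1 \<and>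
       (CARD('n) = 2 \<longrightarrow> A extreme_point_of C \<or> B extreme_point_of C)"
    if P: "P \<notin> cball 0 (3 * r)" "P \<notin> C" and max: "chord_local_maximizer C P A B" for P A B
  proof -
    have "A \<in> frontier C" "B \<in> frontier C"
      using max unfolding chord_local_maximizer_def chord_def by auto
    then have AB: "A \<in> C" "B \<in> C" "A \<notin> interior C" "B \<notin> interior C"
      using closed by (auto simp: frontier_def)
    obtain F G where F: "F face_of C" "A \<in> rel_interior F" and G: "G face_of C" "B \<in> rel_interior G"
      using polytope_point_in_rel_interior_face[OF \<open>polytope C\<close>] AB by metis
    have "A \<in> F" "B \<in> G"
      using F G rel_interior_subset by blast+
    \<comment> \<open>The interior of \<open>C\<close> is nonempty, so it is the relative interior
      of \<open>C\<close>; a face with a relative interior point outside it is proper and lies in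
      the frontier.\<close>
    have proper: "H \<subseteq> frontier C" if "H face_of C" "x \<in> rel_interior H" "x \<notin> interior C" for H x
    proof -
      have "H \<noteq> C"
        using that rel_interior_nonempty_interior[OF \<open>interior C \<noteq> {}\<close>] by auto
      then show ?thesis
        using face_of_subset_rel_frontier[OF that(1)] closed
          rel_interior_nonempty_interior[OF \<open>interior C \<noteq> {}\<close>]
        by (simp add: rel_frontier_def frontier_def)
    qed
    have front: "F \<subseteq> frontier C" "G \<subseteq> frontier C"
      using proper F G AB by blast+
    have "B \<noteq> P"
      using P AB by blast
    have dims: "aff_dim F + aff_dim G \<le> int CARD('n) - 1"
    proof (rule ccontr)
      assume "\<not> ?thesis"
      then have "aff_dim (affine hull F) + aff_dim (affine hull G) \<ge> int DIM(real ^ 'n)"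
        by simp
      then show False
      proof (rule affine_common_direction_or_single_Int
          [OF affine_affine_hull affine_affine_hull hull_inc[OF \<open>A \<in> F\<close>] hull_inc[OF \<open>B \<in> G\<close>]])
        show False if "u \<noteq> 0" "\<And>t. A + t *\<^sub>R u \<in> affine hull F" "\<And>t. B + t *\<^sub>R u \<in> affine hull G" for u
          using chord_local_maximizer_no_common_direction
            [OF max \<open>B \<noteq> P\<close> F(2) front(1) G(2) front(2) that(2,3)] that(1) by blast
      next
        fix q assume q: "affine hull F \<inter> affine hull G = {q}"
        then have "(THE q. affine hull F \<inter> affine hull G = {q}) = q"
          by simp
        then have "q \<in> S"
          unfolding S_def using F(1) G(1) by force
        have "dist P B \<le> dist q A"
          using chord_local_maximizer_far_Int[OF max \<open>B \<noteq> P\<close> F(2) front(1) G(2) front(2)] q by blast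
        also have "\<dots> \<le> 2 * r"
          using r[of q] r[of A] \<open>q \<in> S\<close> AB norm_triangle_ineq4[of q A] by (simp add: dist_norm)
        finally have "norm P \<le> 3 * r"
          using r[of B] AB norm_triangle_sub[of P B] by (simp add: dist_norm)
        then show False
          using P by simp
      qed
    qed
    have *: "x extreme_point_of C" if "H face_of C" "x \<in> H" "aff_dim H \<le> 0" for H x
    proof -
      have "aff_dim H = 0"
        using that aff_dim_negative_iff[of H] by fastforce
      then have "H = {x}"
        using that aff_dim_eq_0[of H] by blast
      then show ?thesis
        using that face_of_singleton by blast
    qed
    have "A extreme_point_of C \<or> B extreme_point_of C" if "CARD('n) = 2"
    proof -
      \<comment> \<open>In the plane the two integer dimensions add up to at most 1, so they cannot
        both be positive.\<close>
      have "aff_dim F \<le> 0 \<or> aff_dim G \<le> 0"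
        using dims that by linarith
      then show ?thesis
        using * F(1) G(1) \<open>A \<in> F\<close> \<open>B \<in> G\<close> by blast
    qed
    moreover have "point_dim C A \<le> aff_dim F" "point_dim C B \<le> aff_dim G"
      using point_dim_le_aff_dim_face F(1) G(1) \<open>A \<in> F\<close> \<open>B \<in> G\<close> by blast+
    ultimately show ?thesis
      using dims by linarith
  qed
  then show ?thesis
    using bounded_cball by blast
qed

end
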